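(* Let $n$ be a positive integer. Then the polynomial $$ \frac{1}{n^2}\sum_{k=0}^{n-1}(2k+1)\sum_{j=0}^{k}{-x-1\choose j}^2{x\choose k-j}^2 $$ in $\mathbb{Q}[x]$ is integer-valued, i.e., it takes an integer value at every $x\in\mathbb{Z}$.
   Context: For a variable $x$ and a non-negative integer $k$, ${x\choose k}$ denotes the polynomial $x(x-1)\cdots(x-k+1)/k!$ (equal to $1$ for $k=0$), and ${-x-1\choose k}$ is this polynomial evaluated at $-x-1$. A polynomial $P(x)\in\mathbb{Q}[x]$ is called integer-valued if $P(x)\in\mathbb{Z}$ for all $x\in\mathbb{Z}$. *)

theory Defs
  imports "HOL-Computational_Algebra.Computational_Algebra"
begin

definition integer_valued :: "rat poly \<Rightarrow> bool" where
  "integer_valued P \<longleftrightarrow> (\<forall>x::int. poly P (of_int x) \<in> \<int>)"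

text \<open>
  The library's \<open>gchoose\<close> is only available over fields, so the polynomial
  $x(x-1)\cdots(x-k+1)/k!$ is written out in \<open>rat poly\<close>; the lemma after the definition
  identifies its values with \<open>gchoose\<close>.
\<close>

definition binom_poly :: "nat \<Rightarrow> rat poly" where
  "binom_poly k = smult (1 / fact k) (\<Prod>i = 0..<k. [:0, 1:] - of_nat i)"

lemma poly_binom_poly: "poly (binom_poly k) a = a gchoose k"
  by (simp add: binom_poly_def gbinomial_prod_rev poly_prod)

end

theory Submission
  imports Defs
begin

text \<open>
  For natural $x$ the inner sum $S_k = \sum_j {x+j \choose j}^2 {x \choose k-j}^2$ equals
  $\sum_m {k+m \choose 2m} {2m \choose m} {x \choose m} {x+m \choose m}$, a form of Clausen's
  formula, because both sides satisfy
  $(k+1)^3 S_{k+1} + k^3 S_{k-1} = (2k+1)(k^2+k+1+2x(x+1)) S_k$. Now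
  $\sum_{k<n} (2k+1) {k+m \choose 2m} = \frac{n(n-m)}{m+1} {n+m \choose 2m}$, which carries a factor
  $n^2$ after multiplication by ${2m \choose m}$, and the denominator $m+1$ is absorbed by
  ${x \choose m}{x+m \choose m} = {2m \choose m}{x+m \choose 2m}$ into a Catalan number.
  The substitution $x \mapsto -1-x$ exchanges the two binomials, so it suffices to treat $x \ge 0$.
\<close>

section \<open>A Clausen-type identity for binomial sums\<close>

lemma of_nat_choose_Suc:
  "(of_nat (n choose Suc k) :: 'a :: field_char_0) = of_nat (n choose k) * (of_nat n - of_nat k) / (of_nat k + 1)"
  using gbinomial_mult_1[of "of_nat n :: 'a" k] of_nat_neq_0[of k, where ?'a = 'a]
  by (simp add: binomial_gbinomial field_simps)

lemma of_nat_choose_diag_Suc: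
  "(of_nat (Suc (n + k) choose Suc k) :: 'a :: field_char_0)
     = of_nat (n + k choose k) * (of_nat n + of_nat k + 1) / (of_nat k + 1)"
proof -
  have "Suc k * (Suc (n + k) choose Suc k) = Suc (n + k) * (n + k choose k)"
    by (simp only: Suc_times_binomial_eq mult.commute)
  then have "of_nat (Suc k * (Suc (n + k) choose Suc k)) = (of_nat (Suc (n + k) * (n + k choose k)) :: 'a)"
    by (simp only:)
  moreover have "(of_nat k + 1 :: 'a) \<noteq> 0"
    by (metis of_nat_Suc of_nat_neq_0 add.commute)
  ultimately show ?thesis
    by (simp add: field_simps del: binomial_Suc_Suc)
qed

section \<open>The two sums, and the recurrence of the first\<close>

definition square_sum :: "nat \<Rightarrow> nat \<Rightarrow> rat" where
  "square_sum x k = (\<Sum>j\<le>k. of_nat (x + j choose j) ^ 2 * of_nat (x choose (k - j)) ^ 2)"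

text \<open>The two binomials in x multiply to the product of x(x+1) - i(i+1) over i < m, divided by
  m!^2, so x enters only through x(x+1).\<close>

definition weight :: "nat \<Rightarrow> nat \<Rightarrow> rat" where
  "weight x m = of_nat (2 * m choose m) * of_nat (x choose m) * of_nat (x + m choose m)"

definition weighted_sum :: "nat \<Rightarrow> nat \<Rightarrow> rat" where
  "weighted_sum x k = (\<Sum>m\<le>k. of_nat (k + m choose (2 * m)) * weight x m)"

text \<open>
  The polynomial factor of a Zeilberger certificate: the recurrence applied to the summand of
  \<open>square_sum\<close> is the difference in $j$ of
  $\mathrm{cert}(x,k,j) {x+j \choose j-1}^2 {x+1 \choose k+1-j}^2$.
\<close>

definition cert_poly :: "rat \<Rightarrow> rat \<Rightarrow> rat \<Rightarrow> rat" where
  "cert_poly x k j = j^2 - 2*j + 3*k - 4*k*j + 3*k^2 - 2*x - 2*x*j + 2*x*j^2 + 2*x*k - 6*x*k*j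
     + 4*x*k^2 - 3*x^2 + 2*x^2*j - 3*x^2*k"

text \<open>This is the certificate equation with the square of binom(x+j,j) binom(x,i-1) / (i(i+1))
  divided out, where i = k - j.\<close>

lemma cert_poly_identity:
  fixes x i j :: rat
  defines "k \<equiv> i + j"
  shows "(k+1)^3 * (x-i+1)^2 * (x-i)^2
      - (2*k+1) * (k^2 + k + 1 + 2*x*(x+1)) * (x-i+1)^2 * (i+1)^2 + k^3 * i^2 * (i+1)^2
    = (x+j+1)^2 * (i+1)^2 * cert_poly x k (j+1) - j^2 * (x-i+1)^2 * cert_poly x k j"
  unfolding cert_poly_def k_def by algebra

text \<open>Balances the top of the sums: the terms j = k and j = k+1 of S_{k+1}, the term j = k of
  S_k and the telescoped boundary value, all divided by binom(x+k,k)^2.\<close>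

lemma cert_poly_boundary:
  "(k+1)^3 * x^2 + (k+1) * (x+k+1)^2 + k^2 * cert_poly x k k = (2*k+1) * (k^2 + k + 1 + 2*x*(x+1))"
  unfolding cert_poly_def by algebra

text \<open>Here i+1 = K - j, so no subtraction of naturals occurs. The certificate's binom(x+j,j-1)
  binom(x+1,K+1-j) is written as j \<open>f j\<close> times \<open>g (i+1)\<close> / (i+2), since
  the factors x+1 cancel.\<close>

lemma square_sum_term:
  fixes x i j :: nat
  defines "X \<equiv> rat_of_nat x" and "K \<equiv> of_nat (i + j) + 1"
  defines "f \<equiv> \<lambda>j. rat_of_nat (x + j choose j)" and "g \<equiv> \<lambda>i. rat_of_nat (x choose i)"
  shows "(K+1)^3 * (f j ^ 2 * g (i+2) ^ 2) - (2*K+1) * (K^2 + K + 1 + 2*X*(X+1)) * (f j ^ 2 * g (i+1) ^ 2)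
        + K^3 * (f j ^ 2 * g i ^ 2)
     = cert_poly X K (of_nat j + 1) * (of_nat j + 1)^2 * f (j+1)^2 * (g i / (of_nat i + 1))^2
     - cert_poly X K (of_nat j) * of_nat j ^ 2 * f j ^ 2 * (g (i+1) / (of_nat i + 2))^2"
proof -
  define I J where "I = rat_of_nat i" and "J = rat_of_nat j"
  have pos: "I + 1 \<noteq> 0" "I + 2 \<noteq> 0" "J + 1 \<noteq> 0"
    by (simp_all add: I_def J_def add_nonneg_eq_0_iff)
  have K: "K = (I + 1) + J" by (simp add: K_def I_def J_def)
  have g1: "g (i+1) = g i * (X - I) / (I + 1)"
    by (simp add: g_def of_nat_choose_Suc X_def I_def)
  have g2: "g (i+2) = g i * (X - I) * (X - I - 1) / ((I + 1) * (I + 2))"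
    by (simp add: g_def of_nat_choose_Suc X_def I_def numeral_2_eq_2 add_ac diff_diff_eq)
  have f1: "f (j+1) = f j * (X + J + 1) / (J + 1)"
    using of_nat_choose_diag_Suc[of x j, where ?'a = rat] by (simp add: f_def X_def J_def)
  define c where "c = (2*K+1) * (K^2 + K + 1 + 2*X*(X+1))"
  define p q where "p = cert_poly X K (J + 1)" and "q = cert_poly X K J"
  have main: "(K+1)^3 * (X-I)^2 * (X-I-1)^2 - c * (X-I)^2 * (I+2)^2 + K^3 * (I+1)^2 * (I+2)^2
      = (X+J+1)^2 * (I+2)^2 * p - J^2 * (X-I)^2 * q"
  proof -
    have "X - (I + 1) + 1 = X - I" "X - (I + 1) = X - I - 1" "I + 1 + 1 = I + 2" by simp_all
    then show ?thesis
      using cert_poly_identity[where x = X and i = "I+1" and j = J]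
      unfolding c_def p_def q_def K by (simp only: mult.assoc)
  qed
  \<comment> \<open>All three values of \<open>g\<close> are polynomial multiples of
    \<open>h\<close>, obtained without dividing by \<open>X - I\<close>, which may vanish.\<close>
  define h where "h = g i / ((I + 1) * (I + 2))"
  have h: "g i / (I + 1) = h * (I + 2)" "g (i+1) / (I + 2) = h * (X - I)"
      "g i = h * ((I + 1) * (I + 2))" "g (i+1) = h * ((X - I) * (I + 2))" "g (i+2) = h * ((X - I) * (X - I - 1))"
    unfolding h_def g1 g2 using pos by simp_all
  have f: "(J + 1)^2 * f (j+1)^2 = f j ^ 2 * (X + J + 1)^2"
    unfolding f1 using pos by (simp add: power_divide power_mult_distrib)
  have "(K+1)^3 * (f j ^ 2 * g (i+2) ^ 2) - c * (f j ^ 2 * g (i+1) ^ 2) + K^3 * (f j ^ 2 * g i ^ 2)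
     = f j ^ 2 * h ^ 2 * ((K+1)^3 * (X-I)^2 * (X-I-1)^2 - c * (X-I)^2 * (I+2)^2 + K^3 * (I+1)^2 * (I+2)^2)"
    unfolding h(3-5) power_mult_distrib
    by (simp only: ring_distribs mult_ac)
  also have "\<dots> = f j ^ 2 * h ^ 2 * ((X+J+1)^2 * (I+2)^2 * p - J^2 * (X-I)^2 * q)"
    by (simp only: main)
  also have "\<dots> = p * ((J + 1)^2 * f (j+1)^2) * (g i / (I + 1))^2 - q * J ^ 2 * f j ^ 2 * (g (i+1) / (I + 2))^2"
    unfolding h(1,2) f power_mult_distrib
    by (simp only: ring_distribs mult_ac)
  finally show ?thesis unfolding c_def p_def q_def I_def J_def mult.assoc .
qed

lemma square_sum_rec:
  fixes x k :: nat
  defines "X \<equiv> rat_of_nat x" and "K \<equiv> of_nat k + 1"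
  shows "(K+1)^3 * square_sum x (k+2) + K^3 * square_sum x k
     = (2*K+1) * (K^2 + K + 1 + 2*X*(X+1)) * square_sum x (k+1)"
proof -
  define f where "f = (\<lambda>j. rat_of_nat (x + j choose j))"
  define g where "g = (\<lambda>i. rat_of_nat (x choose i))"
  define c where "c = (2*K+1) * (K^2 + K + 1 + 2*X*(X+1))"
  define G where "G = (\<lambda>j. cert_poly X K (of_nat j) * of_nat j ^ 2 * f j ^ 2 * (g (k+1-j) / (K + 1 - of_nat j))^2)"
  have step: "(K+1)^3 * (f j ^ 2 * g (k+2-j) ^ 2) - c * (f j ^ 2 * g (k+1-j) ^ 2) + K^3 * (f j ^ 2 * g (k-j) ^ 2)
      = G (Suc j) - G j" if "j \<le> k" for j
  proof -
    define i where "i = k - j"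
    have k: "k = i + j" using that by (simp add: i_def)
    have e: "k + 2 - j = i + 2" "k + 1 - j = i + 1" "k - j = i" "k + 1 - Suc j = i" by (simp_all add: k)
    have d: "K + 1 - of_nat j = of_nat i + 2" "K + 1 - of_nat (Suc j) = of_nat i + 1"
      by (simp_all add: K_def k)
    show ?thesis
      using square_sum_term[where i = i and j = j and x = x] unfolding G_def e d
      unfolding c_def f_def g_def X_def K_def k by (simp add: add.commute)
  qed
  have "(\<Sum>j\<le>k. (K+1)^3 * (f j ^ 2 * g (k+2-j) ^ 2) - c * (f j ^ 2 * g (k+1-j) ^ 2) + K^3 * (f j ^ 2 * g (k-j) ^ 2))
      = (\<Sum>j\<le>k. G (Suc j) - G j)"
    by (intro sum.cong refl step) simp
  also have "\<dots> = G (Suc k) - G 0" by (induction k) auto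
  \<comment> \<open>\<open>G 0\<close> vanishes through its factor j^2; at j = k+1 = K both the
    \<open>g\<close> value and the denominator are 1.\<close>
  also have "\<dots> = cert_poly X K K * K^2 * f (k+1) ^ 2"
    by (simp add: G_def K_def g_def add.commute)
  finally have inner: "(K+1)^3 * (\<Sum>j\<le>k. f j ^ 2 * g (k+2-j) ^ 2) - c * (\<Sum>j\<le>k. f j ^ 2 * g (k+1-j) ^ 2)
      + K^3 * (\<Sum>j\<le>k. f j ^ 2 * g (k-j) ^ 2) = cert_poly X K K * K^2 * f (k+1) ^ 2"
    by (simp add: sum.distrib sum_subtractf sum_distrib_left)
  have s0: "square_sum x k = (\<Sum>j\<le>k. f j ^ 2 * g (k-j) ^ 2)"
    by (simp add: square_sum_def f_def g_def)
  \<comment> \<open>On the common range j \<le> k the truncated subtractions are exact. The terms j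
    = k+1 and j = k+2 of the longer sums are split off and matched with the boundary value by
    \<open>cert_poly_boundary\<close>.\<close>
  have s1: "square_sum x (k+1) = (\<Sum>j\<le>k. f j ^ 2 * g (k+1-j) ^ 2) + f (k+1) ^ 2"
    by (simp add: square_sum_def f_def g_def)
  have s2: "square_sum x (k+2) = (\<Sum>j\<le>k. f j ^ 2 * g (k+2-j) ^ 2) + f (k+1) ^ 2 * X^2 + f (k+2) ^ 2"
    by (simp add: square_sum_def f_def g_def X_def)
  have K1: "K + 1 \<noteq> 0" by (simp add: K_def add_nonneg_eq_0_iff)
  have "f (k+2) = f (k+1) * (X + K + 1) / (K + 1)"
    using of_nat_choose_diag_Suc[of x "k+1", where ?'a = rat]
    by (simp add: f_def X_def K_def add_ac del: binomial_Suc_Suc)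
  then have f2: "(K+1)^3 * f (k+2) ^ 2 = f (k+1)^2 * ((K+1) * (X+K+1)^2)"
    using K1 by (simp add: power_mult_distrib power_divide power3_eq_cube power2_eq_square)
  show ?thesis
    unfolding c_def[symmetric] s0 s1 s2
    using inner f2 arg_cong[OF cert_poly_boundary[of K X, folded c_def], of "\<lambda>t. f (k+1)^2 * t"]
    by (simp only: distrib_left mult_ac)
qed

section \<open>The same recurrence for the weighted sum, and equality of the two sums\<close>

lemma weight_Suc:
  "(of_nat m + 1)^3 * weight x (Suc m)
     = 2 * (2 * of_nat m + 1) * (of_nat x * (of_nat x + 1) - of_nat m * (of_nat m + 1)) * weight x m"
proof -
  define M where "M = rat_of_nat m"
  define X where "X = rat_of_nat x"
  have pos: "M + 1 \<noteq> 0" by (simp add: M_def add_nonneg_eq_0_iff)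
  define t u v where "t = rat_of_nat (2 * m choose m)" and "u = rat_of_nat (x choose m)"
    and "v = rat_of_nat (x + m choose m)"
  have a: "(M + 1) * rat_of_nat (x choose Suc m) = u * (X - M)"
    using pos by (simp add: of_nat_choose_Suc M_def X_def u_def)
  have b: "(M + 1) * rat_of_nat (x + Suc m choose Suc m) = v * (X + M + 1)"
    using of_nat_choose_diag_Suc[of x m, where ?'a = rat] pos
    by (simp add: M_def X_def v_def del: binomial_Suc_Suc)
  \<comment> \<open>Two diagonal steps lead from binom(2m,m) to binom(2m+2,m+1), with the symmetry
    binom(2m+1,m) = binom(2m+1,m+1) between them.\<close>
  have c: "(M + 1) * rat_of_nat (2 * Suc m choose Suc m) = t * (2 * (2 * M + 1))"
  proof -
    have "rat_of_nat (Suc (Suc m + m) choose Suc m)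
        = of_nat (Suc m + m choose m) * (of_nat (Suc m) + of_nat m + 1) / (of_nat m + 1)"
      by (rule of_nat_choose_diag_Suc)
    moreover have "2 * Suc m = Suc (Suc m + m)" by simp
    moreover have "rat_of_nat (Suc m) + of_nat m + 1 = 2 * (M + 1)" by (simp add: M_def)
    ultimately have "rat_of_nat (2 * Suc m choose Suc m) = of_nat (Suc m + m choose m) * (2 * (M + 1)) / (M + 1)"
      by (simp only: M_def)
    also have "\<dots> = of_nat (Suc m + m choose m) * 2"
      by (simp only: mult.assoc[symmetric] nonzero_mult_div_cancel_right[OF pos])
    also have "Suc m + m choose m = (Suc (m + m) choose Suc m)"
      by (metis add_Suc add_diff_cancel_right' binomial_symmetric le_add2)
    also have "rat_of_nat \<dots> = of_nat (m + m choose m) * (of_nat m + of_nat m + 1) / (of_nat m + 1)"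
      by (rule of_nat_choose_diag_Suc)
    also have "\<dots> = t * (2 * M + 1) / (M + 1)"
      by (simp only: M_def t_def mult_2)
    finally have "rat_of_nat (2 * Suc m choose Suc m) = t * (2 * M + 1) / (M + 1) * 2" .
    then show ?thesis using pos by (simp add: field_simps del: binomial_Suc_Suc)
  qed
  have "(M + 1)^3 * weight x (Suc m) = ((M + 1) * rat_of_nat (2 * Suc m choose Suc m))
      * ((M + 1) * rat_of_nat (x choose Suc m)) * ((M + 1) * rat_of_nat (x + Suc m choose Suc m))"
    unfolding weight_def by (simp only: power3_eq_cube mult_ac)
  also have "\<dots> = 2 * (2 * M + 1) * (X * (X + 1) - M * (M + 1)) * (t * u * v)"
    unfolding a b c by algebra
  finally show ?thesis unfolding weight_def t_def u_def v_def M_def X_def .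
qed

text \<open>With m in place of x in the middle coefficient, the recurrence operator collapses to a
  single binomial. At m = 0 the truncated index \<open>2*m-2\<close> is multiplied by
  \<open>M^3\<close> = 0.\<close>

lemma central_choose_rec:
  fixes k m :: nat
  defines "K \<equiv> rat_of_nat k + 1" and "M \<equiv> rat_of_nat m"
  shows "(2*M-1) * ((K+1)^3 * of_nat (k + 2 + m choose (2*m)) + K^3 * of_nat (k + m choose (2*m))
      - (2*K+1) * (K^2 + K + 1 + 2*M*(M+1)) * of_nat (k + 1 + m choose (2*m)))
    = (2*K+1) * M^3 * of_nat (k + m choose (2*m-2))"
proof (cases m)
  case 0
  moreover have "(K+1)^3 + K^3 = (2*K+1) * (K^2 + K + 1)" by algebra
  ultimately show ?thesis by (simp add: M_def)
next
  case (Suc n)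
  define N where "N = rat_of_nat n"
  \<comment> \<open>Raising the lower index by ratios and the upper index by Pascal's rule makes
    every binomial a rational multiple of \<open>b\<close>, which leaves a polynomial
    identity.\<close>
  define b where "b = rat_of_nat (k + m choose (2*n))"
  have M: "M = N + 1" by (simp add: M_def N_def Suc)
  have pos: "2 * N + 1 \<noteq> 0" "N + 1 \<noteq> 0" "2 * N + 2 \<noteq> 0" by (simp_all add: N_def add_nonneg_eq_0_iff)
  have b1: "rat_of_nat (k + m choose (Suc (2*n))) = b * (K - N) / (2 * N + 1)"
    by (simp add: of_nat_choose_Suc b_def K_def N_def Suc add_ac del: binomial_Suc_Suc)
  have b2: "rat_of_nat (k + m choose (Suc (Suc (2*n)))) = b * (K - N) * (K - N - 1) / ((2 * N + 1) * (2 * N + 2))"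
    unfolding of_nat_choose_Suc[of "k + m" "Suc (2*n)"] b1
    by (simp add: K_def N_def Suc add_ac)
  have e: "2 * m = Suc (Suc (2 * n))" "2 * m - 2 = 2 * n" "k + 2 + m = Suc (Suc (k + m))" "k + 1 + m = Suc (k + m)"
    by (simp_all add: Suc)
  have c1: "rat_of_nat (Suc (k + m) choose Suc (Suc (2*n))) = b * (K - N) / (2 * N + 1) + b * (K - N) * (K - N - 1) / ((2 * N + 1) * (2 * N + 2))"
    by (simp only: binomial_Suc_Suc of_nat_add b1 b2)
  have c2: "rat_of_nat (Suc (Suc (k + m)) choose Suc (Suc (2*n))) = b + 2 * (b * (K - N) / (2 * N + 1)) + b * (K - N) * (K - N - 1) / ((2 * N + 1) * (2 * N + 2))"
    by (simp only: binomial_Suc_Suc of_nat_add b1 b2) (simp add: b_def)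
  show ?thesis
    unfolding e(2) unfolding e(1,3,4) c1 c2 b2 b_def[symmetric] M
    using pos by (simp add: divide_simps) algebra
qed

lemma weighted_sum_extend:
  assumes "k \<le> n"
  shows "weighted_sum x k = (\<Sum>m\<le>n. of_nat (k + m choose (2 * m)) * weight x m)"
  unfolding weighted_sum_def using assms by (intro sum.mono_neutral_left) auto

text \<open>Telescoping in m: \<open>central_choose_rec\<close> evaluates the operator with m in
  place of x as \<open>G m\<close>. Restoring x changes the middle coefficient by 2(2K+1)(x(x+1) -
  m(m+1)), and \<open>weight_Suc\<close> turns that contribution into
  \<open>G (Suc m)\<close>.\<close>

lemma weighted_sum_rec:
  fixes x k :: nat
  defines "X \<equiv> rat_of_nat x" and "K \<equiv> of_nat k + 1"
  shows "(K+1)^3 * weighted_sum x (k+2) + K^3 * weighted_sum x k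
     = (2*K+1) * (K^2 + K + 1 + 2*X*(X+1)) * weighted_sum x (k+1)"
proof -
  define B where "B = (\<lambda>l m. rat_of_nat (l + m choose (2 * m)))"
  define c where "c = (2*K+1) * (K^2 + K + 1 + 2*X*(X+1))"
  define G where "G = (\<lambda>m. (2*K+1) * of_nat m^3 / (2 * of_nat m - 1) * of_nat (k + m choose (2*m-2)) * weight x m)"
  have step: "(K+1)^3 * (B (k+2) m * weight x m) + K^3 * (B k m * weight x m) - c * (B (k+1) m * weight x m)
      = G m - G (Suc m)" for m
  proof -
    define M where "M = rat_of_nat m"
    have pos: "2 * M + 1 \<noteq> 0" by (simp add: M_def add_nonneg_eq_0_iff)
    have ne: "2 * M - 1 \<noteq> 0"
    proof
      assume "2 * M - 1 = 0"
      then have "of_nat (2 * m) = (of_nat 1 :: rat)" by (simp add: M_def)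
      then show False by (simp only: of_nat_eq_iff) presburger
    qed
    have w: "(M + 1)^3 * weight x (Suc m) = (2 * M + 1) * (2 * (X * (X + 1) - M * (M + 1)) * weight x m)"
      using weight_Suc[of m x] by (simp only: M_def X_def mult_ac)
    have Gm: "G m = ((K+1)^3 * B (k+2) m + K^3 * B k m - (2*K+1) * (K^2 + K + 1 + 2*M*(M+1)) * B (k+1) m) * weight x m"
    proof -
      have "G m = ((2*K+1) * M^3 * of_nat (k + m choose (2*m-2))) / (2 * M - 1) * weight x m"
        by (simp add: G_def M_def)
      then show ?thesis
        using ne unfolding central_choose_rec[where k = k and m = m, folded K_def M_def, symmetric] B_def by simp
    qed
    have "G (Suc m) = (2*K+1) * B (k+1) m * ((M + 1)^3 * weight x (Suc m)) / (2 * M + 1)"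
      by (simp add: G_def B_def M_def add_ac)
    also have "\<dots> = (2*K+1) * B (k+1) m * (2 * (X * (X + 1) - M * (M + 1))) * weight x m"
      unfolding w using pos by (simp add: mult.assoc)
    finally show ?thesis unfolding Gm c_def by algebra
  qed
  define N where "N = k + 2"
  have "(\<Sum>m\<le>N. (K+1)^3 * (B (k+2) m * weight x m) + K^3 * (B k m * weight x m) - c * (B (k+1) m * weight x m))
      = (\<Sum>m\<le>N. G m - G (Suc m))"
    by (intro sum.cong refl step)
  also have "\<dots> = G 0 - G (Suc N)" by (rule sum_telescope)
  \<comment> \<open>\<open>G 0\<close> contains m^3 = 0, and \<open>G (Suc N)\<close> contains
    binom(2k+3,2k+4) = 0.\<close>
  also have "\<dots> = 0" by (simp add: G_def N_def binomial_eq_0 del: binomial_Suc_Suc)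
  finally have "(K+1)^3 * (\<Sum>m\<le>N. B (k+2) m * weight x m) + K^3 * (\<Sum>m\<le>N. B k m * weight x m)
      = c * (\<Sum>m\<le>N. B (k+1) m * weight x m)"
    by (simp add: sum.distrib sum_subtractf sum_distrib_left)
  moreover have "weighted_sum x l = (\<Sum>m\<le>N. B l m * weight x m)" if "l \<le> k + 2" for l
    unfolding B_def N_def using that by (rule weighted_sum_extend)
  ultimately show ?thesis
    unfolding c_def[symmetric] by simp
qed

lemma square_sum_eq_weighted_sum: "square_sum x k = weighted_sum x k"
proof (induction k rule: less_induct)
  case (less k)
  consider "k = 0" | "k = 1" | l where "k = l + 2"
    by (metis One_nat_def Suc_1 add_2_eq_Suc' not0_implies_Suc)
  then show ?case
  proof cases
    case 3
    \<comment> \<open>The leading coefficient (l+2)^3 is nonzero, so the recurrence and the values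
      at 0 and 1 determine the sequence.\<close>
    have "(of_nat l + 1 + 1 :: rat) ^ 3 \<noteq> 0" by (simp add: add_nonneg_eq_0_iff)
    moreover have "square_sum x l = weighted_sum x l" "square_sum x (l+1) = weighted_sum x (l+1)"
      using 3 by (simp_all add: less.IH)
    ultimately show ?thesis
      using square_sum_rec[where k = l and x = x] weighted_sum_rec[where k = l and x = x] 3
      by (metis add_right_cancel mult_left_cancel)
  qed (simp_all add: square_sum_def weighted_sum_def weight_def power2_eq_square algebra_simps numeral_2_eq_2)
qed

section \<open>Integrality\<close>

text \<open>Induction on n, using the ratio of binom(n+1+m,2m) to binom(n+m,2m). The factor m+1
  stays on the left until a Catalan number supplies it.\<close>

lemma sum_odd_choose:
  "(of_nat m + 1) * (\<Sum>k<n. (2 * of_nat k + 1) * rat_of_nat (k + m choose (2 * m)))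
     = of_nat n * (of_nat n - of_nat m) * of_nat (n + m choose (2 * m))"
proof (induction n)
  case 0
  then show ?case by simp
next
  case (Suc n)
  have "(of_nat n + 1 - of_nat m) * rat_of_nat (Suc n + m choose (2 * m))
      = (of_nat n + of_nat m + 1) * of_nat (n + m choose (2 * m))"
  proof (cases "m \<le> n")
    case True
    have "Suc (n + m) * (n + m choose (2 * m)) = (Suc (n + m) choose (2 * m)) * (Suc (n + m) - 2 * m)"
      using binomial_absorb_comp[of "Suc (n+m)" "2*m"] by (simp add: mult.commute)
    then have "rat_of_nat (Suc (n + m) * (n + m choose (2 * m)))
        = of_nat ((Suc (n + m) choose (2 * m)) * (Suc (n + m) - 2 * m))"
      by (simp only:)
    moreover have "rat_of_nat (Suc (n + m) - 2 * m) = of_nat n + 1 - of_nat m"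
      using True by (subst of_nat_diff) auto
    ultimately show ?thesis
      by (simp only: of_nat_mult of_nat_Suc of_nat_add add_Suc add_Suc_right mult.commute add_ac)
  next
    case False
    \<comment> \<open>At m = n+1 the left factor and the right binomial are zero; for larger m both
      binomials are zero.\<close>
    then show ?thesis by (cases "m = Suc n") (auto simp: not_le binomial_eq_0 simp del: binomial_Suc_Suc)
  qed
  with Suc show ?case by (simp add: algebra_simps) algebra
qed

text \<open>The difference form makes integrality immediate; \<open>catalan_mult\<close> recovers
  the usual quotient binom(2m,m)/(m+1).\<close>

definition catalan :: "nat \<Rightarrow> int" where
  "catalan m = int (2 * m choose m) - int (2 * m choose Suc m)"

lemma catalan_mult: "(of_nat m + 1) * of_int (catalan m) = rat_of_nat (2 * m choose m)"
proof -
  have "(of_nat m + 1) * rat_of_nat (2 * m choose Suc m) = of_nat m * of_nat (2 * m choose m)"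
    by (simp add: of_nat_choose_Suc add_nonneg_eq_0_iff)
  then show ?thesis by (simp add: catalan_def algebra_simps)
qed

lemma choose_shift_mult:
  assumes "m \<le> n"
  shows "(n + m choose (2 * m)) * (2 * m choose m) = (n + m choose m) * (n choose m)"
  using choose_mult[of m "2 * m" "n + m"] assms by simp

lemma weight_eq: "weight x m = of_nat (2 * m choose m) ^ 2 * of_nat (x + m choose (2 * m))"
proof (cases "m \<le> x")
  case True
  have "rat_of_nat ((x + m choose (2 * m)) * (2 * m choose m)) = of_nat ((x + m choose m) * (x choose m))"
    by (simp only: choose_shift_mult[OF True])
  then show ?thesis by (simp add: weight_def power2_eq_square mult_ac)
qed (simp add: weight_def binomial_eq_0)

text \<open>After the order of summation is exchanged, \<open>weight_eq\<close> offers two factors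
  binom(2m,m). One is (m+1) times a Catalan number and clears the denominator of
  \<open>sum_odd_choose\<close>; the other turns binom(n+m,2m) into binom(n+m,m) binom(n,m). Then
  (n-m) binom(n,m) = n binom(n-1,m) gives the second factor n.\<close>

lemma sum_square_sum:
  assumes "n > 0"
  shows "(\<Sum>k<n. (2 * of_nat k + 1) * square_sum x k)
     = of_nat n ^ 2 * of_int (\<Sum>m<n. int ((n + m choose m) * (n - 1 choose m) * (x + m choose (2 * m))) * catalan m)"
proof -
  have "(\<Sum>k<n. (2 * of_nat k + 1) * square_sum x k)
      = (\<Sum>k<n. \<Sum>m<n. (2 * of_nat k + 1) * rat_of_nat (k + m choose (2 * m)) * weight x m)"
  proof (intro sum.cong refl)
    fix k assume "k \<in> {..<n}"
    then have "square_sum x k = (\<Sum>m\<le>n - 1. rat_of_nat (k + m choose (2 * m)) * weight x m)"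
      by (subst square_sum_eq_weighted_sum, intro weighted_sum_extend) auto
    also have "{..n - 1} = {..<n}" using assms by auto
    finally show "(2 * of_nat k + 1) * square_sum x k
        = (\<Sum>m<n. (2 * of_nat k + 1) * rat_of_nat (k + m choose (2 * m)) * weight x m)"
      by (simp add: sum_distrib_left mult.assoc)
  qed
  also have "\<dots> = (\<Sum>m<n. (\<Sum>k<n. (2 * of_nat k + 1) * rat_of_nat (k + m choose (2 * m))) * weight x m)"
    by (subst sum.swap) (simp add: sum_distrib_right)
  also have "\<dots> = (\<Sum>m<n. of_nat n ^ 2 * (of_nat ((n + m choose m) * (n - 1 choose m) * (x + m choose (2 * m))) * of_int (catalan m)))"
  proof (intro sum.cong refl)
    fix m assume "m \<in> {..<n}"
    then have m: "m \<le> n" by simp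
    define S where "S = (\<Sum>k<n. (2 * of_nat k + 1) * rat_of_nat (k + m choose (2 * m)))"
    define c where "c = rat_of_nat (2 * m choose m)"
    define d where "d = rat_of_nat (x + m choose (2 * m))"
    have S: "(of_nat m + 1) * S = of_nat n * (of_nat n - of_nat m) * of_nat (n + m choose (2 * m))"
      unfolding S_def by (rule sum_odd_choose)
    have "rat_of_nat ((n + m choose (2 * m)) * (2 * m choose m)) = of_nat ((n + m choose m) * (n choose m))"
      by (simp only: choose_shift_mult[OF m])
    then have e: "rat_of_nat (n + m choose (2 * m)) * c = of_nat (n + m choose m) * of_nat (n choose m)"
      by (simp add: c_def)
    have "rat_of_nat ((n - m) * (n choose m)) = of_nat (n * (n - 1 choose m))"
      by (simp only: binomial_absorb_comp)
    then have h: "(of_nat n - of_nat m) * rat_of_nat (n choose m) = of_nat n * of_nat (n - 1 choose m)"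
      using m by (simp add: of_nat_diff)
    have cat: "c = (of_nat m + 1) * of_int (catalan m)" by (simp add: catalan_mult c_def)
    have "S * weight x m = ((of_nat m + 1) * S) * of_int (catalan m) * c * d"
      by (simp add: weight_eq power2_eq_square c_def[symmetric] d_def[symmetric]) (simp add: cat)
    also have "\<dots> = of_nat n ^ 2 * (of_nat (n + m choose m) * of_nat (n - 1 choose m) * d * of_int (catalan m))"
      unfolding S using e h by algebra
    finally show "S * weight x m
        = of_nat n ^ 2 * (of_nat ((n + m choose m) * (n - 1 choose m) * (x + m choose (2 * m))) * of_int (catalan m))"
      by (simp add: d_def)
  qed
  finally show ?thesis by (simp add: sum_distrib_left)
qed

section \<open>From natural to integer arguments\<close>

lemma gchoose_neg_square:
  "((- of_nat x - 1 :: rat) gchoose j) ^ 2 = of_nat (x + j choose j) ^ 2"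
proof -
  have "(- (of_nat x + 1) :: rat) gchoose j = (- 1) ^ j * of_nat (x + j choose j)"
    unfolding gbinomial_minus binomial_gbinomial by (simp add: algebra_simps)
  then show ?thesis by (simp add: power_mult_distrib power_even_eq[symmetric] power_mult[symmetric])
qed

text \<open>\<open>y\<close> is the nonnegative one of x and -x-1. For negative x the two binomials
  trade places, which the reversal of j to k-j undoes.\<close>

lemma sum_gchoose_eq_square_sum:
  fixes x :: int
  defines "y \<equiv> (if x \<ge> 0 then nat x else nat (- x - 1))"
  shows "(\<Sum>j = 0..k. ((- of_int x - 1 :: rat) gchoose j) ^ 2 * (of_int x gchoose (k - j)) ^ 2)
    = square_sum y k"
proof (cases "x \<ge> 0")
  case True
  then have x: "rat_of_int x = of_nat y" by (simp add: y_def)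
  show ?thesis unfolding x gchoose_neg_square square_sum_def
    by (simp add: atLeast0AtMost binomial_gbinomial)
next
  case False
  then have x: "rat_of_int x = - of_nat y - 1" by (simp add: y_def)
  have "(\<Sum>j = 0..k. ((- of_int x - 1 :: rat) gchoose j) ^ 2 * (of_int x gchoose (k - j)) ^ 2)
      = (\<Sum>j\<le>k. of_nat (y choose j) ^ 2 * of_nat (y + (k - j) choose (k - j)) ^ 2)"
    unfolding x gchoose_neg_square by (simp add: atLeast0AtMost binomial_gbinomial)
  also have "\<dots> = square_sum y k"
    unfolding square_sum_def by (subst sum.nat_diff_reindex[symmetric, where n = "Suc k", unfolded lessThan_Suc_atMost])
      (auto intro!: sum.cong simp: mult.commute)
  finally show ?thesis .
qed

theorem theorem1p3:
  fixes n :: nat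
  assumes "n > 0"
  shows "integer_valued
    (smult (1 / of_nat n ^ 2)
      (\<Sum>k = 0..n - 1. of_nat (2 * k + 1) *
        (\<Sum>j = 0..k. (binom_poly j \<circ>\<^sub>p [:-1, -1:]) ^ 2 * binom_poly (k - j) ^ 2)))"
  unfolding integer_valued_def
proof
  fix x :: int
  define y where "y = (if x \<ge> 0 then nat x else nat (- x - 1))"
  have I: "{0..n - 1} = {..<n}" using assms by auto
  have e: "- 1 - rat_of_int x = - of_int x - 1" by simp
  have "poly (smult (1 / of_nat n ^ 2)
      (\<Sum>k = 0..n - 1. of_nat (2 * k + 1) *
        (\<Sum>j = 0..k. (binom_poly j \<circ>\<^sub>p [:-1, -1:]) ^ 2 * binom_poly (k - j) ^ 2))) (of_int x)
      = 1 / of_nat n ^ 2 * (\<Sum>k<n. (2 * of_nat k + 1) * square_sum y k)"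
    unfolding I by (simp add: poly_sum poly_pcompose poly_binom_poly e y_def
      sum_gchoose_eq_square_sum add.commute)
  also have "\<dots> \<in> \<int>"
    unfolding sum_square_sum[OF assms] using assms by (simp del: of_int_sum)
  finally show "poly (smult (1 / of_nat n ^ 2)
      (\<Sum>k = 0..n - 1. of_nat (2 * k + 1) *
        (\<Sum>j = 0..k. (binom_poly j \<circ>\<^sub>p [:-1, -1:]) ^ 2 * binom_poly (k - j) ^ 2))) (of_int x) \<in> \<int>" .
qed

end
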